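(* Let $a(1)<a(2)<\cdots$ be the increasing enumeration of the positive integers $n$ with $\{n\sqrt2\}<\tfrac12$, and let $b(1)<b(2)<\cdots$ be the increasing enumeration of the complementary set of positive integers, i.e. those $n$ with $\{n\sqrt2\}\ge\tfrac12$. Then $b(n)-a(n)>0$ for every integer $n\ge1$.
   Context: $\{x\}=x-\lfloor x\rfloor$ denotes the fractional part of a real number $x$. (The sequences start $a=1,3,5,6,8,10,\dots$ and $b=2,4,7,9,11,12,\dots$.) *)

theory Defs
  imports Complex_Main "HOL-Library.Infinite_Set"
begin

definition A :: "nat set" where
  "A = {n. n \<ge> 1 \<and> frac (real n * sqrt 2) < 1 / 2}"

definition B :: "nat set" where
  "B = {n. n \<ge> 1 \<and> frac (real n * sqrt 2) \<ge> 1 / 2}"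

(* enumerate counts from 0, whereas the sequences are indexed from 1;
   the values at 0 are junk. *)

definition a :: "nat \<Rightarrow> nat" where
  "a n = enumerate A (n - 1)"

definition b :: "nat \<Rightarrow> nat" where
  "b n = enumerate B (n - 1)"

(* enumerate is an increasing enumeration only on infinite sets, so we
   check that both sets are infinite. *)

lemma sqrt2_bounds: "7 / 5 < sqrt (2::real)" "sqrt (2::real) < 3 / 2"
  by (rule real_less_rsqrt, simp add: power2_eq_square)
     (rule real_less_lsqrt, simp_all add: power2_eq_square)

lemma frac_add_sqrt2:
  "frac (real (Suc n) * sqrt 2) = frac (real n * sqrt 2) + (sqrt 2 - 1) \<or>
   frac (real (Suc n) * sqrt 2) = frac (real n * sqrt 2) + (sqrt 2 - 2)"
proof -
  define x where "x = real n * sqrt 2"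
  have x: "real (Suc n) * sqrt 2 = x + sqrt 2"
    by (simp add: x_def algebra_simps)
  have "\<lfloor>x + sqrt 2\<rfloor> = \<lfloor>x\<rfloor> + 1 \<or> \<lfloor>x + sqrt 2\<rfloor> = \<lfloor>x\<rfloor> + 2"
    using sqrt2_bounds by (simp add: floor_eq_iff) linarith
  then show ?thesis
    unfolding x x_def[symmetric] frac_def by auto
qed

lemma infinite_A: "infinite A"
  unfolding infinite_nat_iff_unbounded_le
proof
  fix m
  define k where "k = Suc m"
  have "\<exists>n\<in>{k, Suc k, Suc (Suc k)}. frac (real n * sqrt 2) < 1 / 2"
    using frac_add_sqrt2[of k] frac_add_sqrt2[of "Suc k"] sqrt2_bounds
      frac_lt_1[of "real k * sqrt 2"] frac_lt_1[of "real (Suc k) * sqrt 2"]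
      frac_lt_1[of "real (Suc (Suc k)) * sqrt 2"]
    unfolding bex_simps by argo
  then show "\<exists>n\<ge>m. n \<in> A"
    by (auto simp: A_def k_def simp del: of_nat_Suc intro: exI[of _ "Suc m"] exI[of _ "Suc (Suc m)"] exI[of _ "Suc (Suc (Suc m))"])
qed

lemma infinite_B: "infinite B"
  unfolding infinite_nat_iff_unbounded_le
proof
  fix m
  define k where "k = Suc m"
  have "\<exists>n\<in>{k, Suc k, Suc (Suc k)}. frac (real n * sqrt 2) \<ge> 1 / 2"
    using frac_add_sqrt2[of k] frac_add_sqrt2[of "Suc k"] sqrt2_bounds
      frac_ge_0[of "real k * sqrt 2"] frac_ge_0[of "real (Suc k) * sqrt 2"]
      frac_ge_0[of "real (Suc (Suc k)) * sqrt 2"]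
    unfolding bex_simps by argo
  then show "\<exists>n\<ge>m. n \<in> B"
    by (auto simp: B_def k_def simp del: of_nat_Suc intro: exI[of _ "Suc m"] exI[of _ "Suc (Suc m)"] exI[of _ "Suc (Suc (Suc m))"])
qed

end

theory Submission
  imports Defs "HOL-Computational_Algebra.Primes"
begin

text \<open>
  Put $t(n) = (-1)^{\lfloor 2n\sqrt 2 \rfloor}$, which is $1$ for $n \in A$ and $-1$ for
  $n \in B$. The claim amounts to all partial sums $S(N) = t(1) + \dots + t(N)$ (the
  function \<open>excess\<close>) being nonnegative: then the initial segment up to $b(n)$, which holds $n$
  elements of $B$, also holds at least $n$ elements of $A$.

  The sums are nonnegative because they reproduce themselves on a smaller scale. The number
  $\varepsilon = 3 - 2\sqrt 2$ is small, so $2n\sqrt 2 = 3n - n\varepsilon$ shows that $t$ alternates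
  on each block of indices $n$ on which $\lfloor n\varepsilon \rfloor$ is constant. It is also a unit:
  $1/\varepsilon = 3 + 2\sqrt 2$. Hence the $k$-th block starts just after
  $\lfloor k/\varepsilon \rfloor = 3k + \lfloor 2k\sqrt 2 \rfloor$, and this makes the sign at its
  start equal to $t(k)$. So the sign at the start of block $k \<ge> 1$ makes the same change to $S$ as
  the step from $k - 1$ to $k$ does, and the other signs just alternate. This gives the
  renormalization identity \<open>excess_contract\<close>: with $K = \lfloor N\varepsilon \rfloor < N$,
  $$S(N) = S(K) + ((N - K) \bmod 2),$$
  and $S \ge 0$ follows by strong induction.
\<close>

text \<open>
  This turns the comparison of two enumerations into a comparison of counting functions. If the
  $k$-th element of $S$ came after $N$, the $k$-th element of $T$, then (counting from $0$) the
  segment up to $N$ would hold at most $k$ elements of $S$ but $k + 1$ of $T$.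
\<close>

lemma enumerate_less_enumerate_of_card_le:
  fixes S T :: "nat set"
  assumes "infinite S" "infinite T" "S \<inter> T = {}"
    and card_le: "\<And>N. card (T \<inter> {..N}) \<le> card (S \<inter> {..N})"
  shows "enumerate S k < enumerate T k"
proof (rule ccontr)
  define N where "N = enumerate T k"
  assume "\<not> enumerate S k < enumerate T k"
  moreover have "enumerate S k \<noteq> enumerate T k"
    using assms(1-3) enumerate_in_set by (metis disjoint_iff)
  ultimately have less: "N < enumerate S k"
    by (simp add: N_def)
  have "S \<inter> {..N} \<subseteq> enumerate S ` {..<k}"
  proof
    fix x assume x: "x \<in> S \<inter> {..N}"
    then obtain j where j: "enumerate S j = x"
      using enumerate_Ex assms(1) by blast
    with x less have "enumerate S j < enumerate S k" by simp
    with assms(1) j show "x \<in> enumerate S ` {..<k}" by auto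
  qed
  then have "card (S \<inter> {..N}) \<le> k"
    using surj_card_le[of "{..<k}"] by simp
  moreover have "enumerate T ` {..k} \<subseteq> T \<inter> {..N}"
    using assms(2) by (auto simp: N_def enumerate_in_set)
  then have "card (enumerate T ` {..k}) \<le> card (T \<inter> {..N})"
    by (intro card_mono) auto
  then have "Suc k \<le> card (T \<inter> {..N})"
    using inj_enumerate[OF assms(2)] by (simp add: card_image inj_on_subset)
  ultimately show False
    using card_le[of N] by simp
qed

lemma frac_less_half_iff: "frac x < 1 / 2 \<longleftrightarrow> even \<lfloor>2 * x\<rfloor>" for x :: real
proof (cases "frac x < 1 / 2")
  case True
  then have "\<lfloor>2 * x\<rfloor> = 2 * \<lfloor>x\<rfloor>"
    unfolding frac_def by (simp add: floor_eq_iff)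
  with True show ?thesis by simp
next
  case False
  then have "\<lfloor>2 * x\<rfloor> = 2 * \<lfloor>x\<rfloor> + 1"
    unfolding frac_def by (simp add: floor_eq_iff) linarith
  with False show ?thesis by simp
qed

lemma mem_A_iff: "n \<in> A \<longleftrightarrow> n \<ge> 1 \<and> even \<lfloor>2 * (real n * sqrt 2)\<rfloor>"
  by (simp only: A_def mem_Collect_eq frac_less_half_iff)

lemma mem_B_iff: "n \<in> B \<longleftrightarrow> n \<ge> 1 \<and> odd \<lfloor>2 * (real n * sqrt 2)\<rfloor>"
  by (simp only: B_def mem_Collect_eq not_less[symmetric] frac_less_half_iff)

text \<open>
  Irrationality of $\sqrt 2$: in $m^2 = 8n^2$ the exponent of $2$ is even on the left and odd on
  the right. It makes the inequalities that determine the floors below strict.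
\<close>

lemma mult_sqrt2_neq_int:
  assumes "n > 0"
  shows "2 * (real n * sqrt 2) \<noteq> of_int m"
proof
  assume "2 * (real n * sqrt 2) = of_int m"
  then have "(2 * (real n * sqrt 2))\<^sup>2 = (of_int m)\<^sup>2"
    by simp
  then have "of_int (m\<^sup>2) = (of_int (2 ^ 3 * (int n)\<^sup>2) :: real)"
    by (simp add: power_mult_distrib)
  then have eq: "m\<^sup>2 = 2 ^ 3 * (int n)\<^sup>2"
    by (simp only: of_int_eq_iff)
  with assms have "m \<noteq> 0"
    by auto
  then have "multiplicity 2 (m\<^sup>2) = 2 * multiplicity 2 m"
    by (simp add: prime_elem_multiplicity_power_distrib)
  moreover have "multiplicity 2 (2 ^ 3 * (int n)\<^sup>2) = 3 + 2 * multiplicity 2 (int n)"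
    using assms by (simp add: prime_elem_multiplicity_mult_distrib
        prime_elem_multiplicity_power_distrib del: power_numeral)
  ultimately have "2 * multiplicity 2 m = 3 + 2 * multiplicity 2 (int n)"
    using eq by simp
  then show False
    by presburger
qed

text \<open>
  The index of the block that contains $N$, for the division of the indices into maximal
  alternating runs described above.
\<close>

definition contract :: "nat \<Rightarrow> nat" where
  "contract N = nat \<lfloor>real N * (3 - 2 * sqrt 2)\<rfloor>"

lemma contract_bounds:
  "real (contract N) \<le> real N * (3 - 2 * sqrt 2)"
  "real N * (3 - 2 * sqrt 2) < real (contract N) + 1"
proof -
  have "0 \<le> real N * (3 - 2 * sqrt 2)"
    using sqrt2_bounds by simp
  then show "real (contract N) \<le> real N * (3 - 2 * sqrt 2)"
    "real N * (3 - 2 * sqrt 2) < real (contract N) + 1"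
    unfolding contract_def by linarith+
qed

lemma contract_0 [simp]: "contract 0 = 0"
  by (simp add: contract_def)

lemma contract_less: "N > 0 \<Longrightarrow> contract N < N"
proof -
  assume "N > 0"
  then have "real N * (3 - 2 * sqrt 2) < real N * 1"
    using sqrt2_bounds by (intro mult_strict_left_mono) auto
  with contract_bounds(1)[of N] show ?thesis by simp
qed

lemma contract_Suc: "contract (Suc N) = contract N \<or> contract (Suc N) = Suc (contract N)"
proof -
  have "real (Suc N) * (3 - 2 * sqrt 2) = real N * (3 - 2 * sqrt 2) + (3 - 2 * sqrt 2)"
    by (simp add: algebra_simps)
  then show ?thesis
    using contract_bounds[of N] contract_bounds[of "Suc N"] sqrt2_bounds by linarith
qed

lemma floor_eq_contract:
  assumes "N > 0"
  shows "\<lfloor>2 * (real N * sqrt 2)\<rfloor> = 3 * int N - int (contract N) - 1"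
proof -
  have "2 * (real N * sqrt 2) \<noteq> of_int (3 * int N - int (contract N))"
    by (rule mult_sqrt2_neq_int[OF assms])
  then show ?thesis
    using contract_bounds[of N] unfolding floor_eq_iff by (simp add: algebra_simps)
qed

text \<open>
  If a new block $k$ starts at $N + 1$, then $N\varepsilon < k < (N + 1)\varepsilon$. Multiplication
  by the inverse $3 + 2\sqrt 2$ of $\varepsilon$ gives $N < 3k + 2k\sqrt 2 < N + 1$, so the parity at
  $k$ is that of $N - k$. By \<open>floor_eq_contract\<close> this is also the parity at $N + 1$.
\<close>

lemma floor_at_jump:
  assumes "contract (Suc N) = Suc (contract N)"
  shows "\<lfloor>2 * (real (contract (Suc N)) * sqrt 2)\<rfloor> = int N - 3 * int (contract (Suc N))"
proof -
  define k where "k = contract (Suc N)"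
  define x where "x = 3 + 2 * sqrt 2"
  have x: "x > 0" "(3 - 2 * sqrt 2) * x = 1"
    by (simp_all add: x_def algebra_simps add_pos_nonneg)
  have "real N * (3 - 2 * sqrt 2) < real k" "real k \<le> real (Suc N) * (3 - 2 * sqrt 2)"
    using contract_bounds[of N] contract_bounds[of "Suc N"] assms by (simp_all add: k_def)
  then have "real N * (3 - 2 * sqrt 2) * x < real k * x"
    and "real k * x \<le> real (Suc N) * (3 - 2 * sqrt 2) * x"
    using x(1) by (auto intro: mult_strict_right_mono mult_right_mono)
  then have "real N < real k * x" "real k * x \<le> real (Suc N)"
    using x(2) by (simp_all add: mult.assoc)
  moreover have "2 * (real k * sqrt 2) \<noteq> of_int (int (Suc N) - 3 * int k)"
    using assms by (intro mult_sqrt2_neq_int) (simp add: k_def)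
  ultimately have "\<lfloor>2 * (real k * sqrt 2)\<rfloor> = int N - 3 * int k"
    unfolding floor_eq_iff by (simp add: x_def algebra_simps)
  then show ?thesis by (simp add: k_def)
qed

definition excess :: "nat \<Rightarrow> int" where
  "excess N = int (card (A \<inter> {..N})) - int (card (B \<inter> {..N}))"

lemma excess_0 [simp]: "excess 0 = 0"
proof -
  have "A \<inter> {..0} = {}" "B \<inter> {..0} = {}" by (auto simp: A_def B_def)
  then show ?thesis by (simp add: excess_def)
qed

lemma excess_Suc:
  "excess (Suc N) = excess N + (if even \<lfloor>2 * (real (Suc N) * sqrt 2)\<rfloor> then 1 else - 1)"
proof (cases "even \<lfloor>2 * (real (Suc N) * sqrt 2)\<rfloor>")
  case True
  then have "Suc N \<in> A" "Suc N \<notin> B"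
    by (simp_all add: mem_A_iff mem_B_iff)
  with True show ?thesis by (simp add: excess_def atMost_Suc del: of_nat_Suc)
next
  case False
  then have "Suc N \<notin> A" "Suc N \<in> B"
    by (simp_all add: mem_A_iff mem_B_iff)
  with False show ?thesis by (simp add: excess_def atMost_Suc del: of_nat_Suc)
qed

text \<open>
  Both sides change alike when $N$ grows by $1$. Inside a block the argument $K$ of the right-hand
  $S$ stays fixed, and the alternating sign switches the remainder between $0$ and $1$. At the start
  of a block $N - K$ stays fixed, and the sign at $N + 1$ agrees with the one at $K + 1$.
\<close>

lemma excess_contract:
  "excess N = excess (contract N) + (int N - int (contract N)) mod 2"
proof (induction N)
  case 0
  show ?case by simp
next
  case (Suc N)
  have step: "excess (Suc N) = excess N + (if even (int N - int (contract (Suc N))) then 1 else - 1)"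
    unfolding excess_Suc by (simp add: floor_eq_contract del: of_nat_Suc)
  from contract_Suc[of N] show ?case
  proof
    assume "contract (Suc N) = contract N"
    with Suc step show ?case
      by (simp; presburger)
  next
    assume jump: "contract (Suc N) = Suc (contract N)"
    have "even \<lfloor>2 * (real (Suc (contract N)) * sqrt 2)\<rfloor> \<longleftrightarrow> even (int N - int (contract (Suc N)))"
      using floor_at_jump[OF jump] by (simp add: jump)
    then have "excess (contract (Suc N)) =
        excess (contract N) + (if even (int N - int (contract (Suc N))) then 1 else - 1)"
      unfolding jump excess_Suc by simp
    with Suc step jump show ?case by simp
  qed
qed

lemma excess_nonneg: "excess N \<ge> 0"
proof (induction N rule: less_induct)
  case (less N)
  show ?case
  proof (cases "N = 0")
    case False
    then have "excess (contract N) \<ge> 0"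
      by (intro less contract_less) simp
    then show ?thesis
      by (subst excess_contract) simp
  qed simp
qed

theorem corollary2:
  fixes n :: nat
  assumes "n \<ge> 1"
  shows "int (b n) - int (a n) > 0"
proof -
  have "A \<inter> B = {}"
    by (auto simp: A_def B_def)
  moreover have "card (B \<inter> {..N}) \<le> card (A \<inter> {..N})" for N
    using excess_nonneg[of N] by (simp add: excess_def)
  ultimately have "a n < b n"
    unfolding a_def b_def
    by (intro enumerate_less_enumerate_of_card_le infinite_A infinite_B)
  then show ?thesis by simp
qed

end
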